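(* Assume that there exists a weight $2$ modular form $\chi\in M_2$ which is invertible in $R$, let $u=x\chi$, and for any nonnegative integer $k$ let $g_{k,2n}\in M_{2n}$ be defined by $\Psi_2^{-1}(u^k)=\sum_{n\ge k}g_{k,2n}$. For any nonnegative integers $k$ and $i$, we have $$g_{k,2k+2i}=(-1)^i\frac{(k+i)!\,(k+i-1)!}{(2k+2i-2)!\,k!}\sum_{\substack{(t_1,\ldots,t_k)\in(\mathbb{Z}_{\ge0})^k\\ t_1+\cdots+t_k=i}}\gamma_i(t_1,\ldots,t_k)\,\frac{\chi^{(t_1)}}{(t_1+1)!}\cdots\frac{\chi^{(t_k)}}{(t_k+1)!},$$ where the coefficients $\gamma_i(t_1,\ldots,t_k)$ are defined for $(t_1,\ldots,t_k)\in(\mathbb{Z}_{\ge0})^k$ such that $\sum_{j=1}^kt_j=i$ by $$\gamma_i(t_1,\ldots,t_k)=\sum_{r=0}^i(-1)^r\frac{(2k+2i-2-r)!}{(k+i-1-r)!}\sum_{\substack{b_1+\cdots+b_k=r\\ 0\le b_1\le t_1,\ \ldots,\ 0\le b_k\le t_k}}\binom{t_1+1}{b_1}\cdots\binom{t_k+1}{b_k}$$ and satisfy $$\frac{\gamma_i(t_1,\ldots,t_k)}{(k+i-1)!}=\sum_{a_1+\cdots+a_k\le k+i-1}\binom{k+i-2}{a_1+\cdots+a_k-1}\prod_{j=1}^k\bigl[(-1)^{t_j}\delta(a_j=0)+\delta(a_j=t_j+1)\bigr],$$ where the $a_j$ are nonnegative integers and $\delta$ is the Kronecker symbol: $\delta(P)=1$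 if $P$ holds and $\delta(P)=0$ otherwise.
   Context: $\Gamma$ is a subgroup of $\mathrm{SL}(2,\mathbb{C})$ and $R$ is a commutative $\mathbb{C}$-algebra of functions in one variable $z$, which is a domain, such that: (i) $\Gamma$ acts on the right on $R$ by automorphisms $(f\cdot\gamma)(z)=f\left(\frac{az+b}{cz+d}\right)$ for $\gamma=\begin{pmatrix}a&b\\c&d\end{pmatrix}$; (ii) the function $z\mapsto cz+d$ is an invertible element of $R$ for every $\gamma\in\Gamma$; (iii) $R$ is stable under $\partial_z=\frac{d}{dz}$, which is nonzero on $R$. Put $d_z=-\partial_z$ and $f^{(n)}=\partial_z^nf$. For $k\in\mathbb{Z}$, $M_k=\{f\in R: f\left(\frac{az+b}{cz+d}\right)=(cz+d)^kf(z)\ \text{for all }\gamma\in\Gamma\}$ is the space of weight $k$ modular forms. It is assumed that $M_k\cap M_\ell=\{0\}$ for $k\ne\ell$; elements of $\prod_{j\ge0}M_{2j}$ are written as formal sums of their components. $B=R(\!(x;d_z)\!)$ is the ring of Laurent series $\sum_{i\ge m}f_ix^i$ ($m\in\mathbb{Z}$, $f_i\in R$) with commutation law $xf=\sum_{n\ge0}d_z^n(f)x^{n+1}$ for $f\in R$; $B_0$ is its subring of power series in $x$. $\Gamma$ acts on $B$ by automorphisms extending the action on $R$, with $(x^{-1}|\gamma)=(cz+d)^2x^{-1}$; $B_0^\Gamma$ is the subring of invariant elements of $B_0$, and $u=x\chi\in B_0^\Gamma$. $\Psi_2:\prod_{j\ge0}M_{2j}\to B_0^\Gamma$ is the vector space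 isomorphism $\sum_jf_{2j}\mapsto\sum_j\psi_{2j}(f_{2j})$, where $\psi_0(f)=f$ and, for $j\ge1$, $$\psi_{2j}(f)=\sum_{n\ge0}\frac{(2j-1)!\,(n+j-1)!}{(n+2j-1)!\,(j-1)!}\binom{-j-1}{n}f^{(n)}x^{j+n}.$$ *)

theory Defs
  imports
    "HOL-Analysis.Analysis"
    "HOL-Algebra.Group"
    "HOL-Computational_Algebra.Formal_Power_Series"
begin

definition SL2C :: "(complex^2^2) monoid" where
  "SL2C = \<lparr>carrier = {A. det A = 1}, mult = (**), one = mat 1\<rparr>"

definition moebius :: "complex^2^2 \<Rightarrow> complex \<Rightarrow> complex" where
  "moebius A z = (A $ 1 $ 1 * z + A $ 1 $ 2) / (A $ 2 $ 1 * z + A $ 2 $ 2)"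

definition aut_factor :: "complex^2^2 \<Rightarrow> complex \<Rightarrow> complex" where
  "aut_factor A z = A $ 2 $ 1 * z + A $ 2 $ 2"

definition modular_forms ::
  "(complex^2^2) set \<Rightarrow> complex filter \<Rightarrow> ('r \<Rightarrow> complex \<Rightarrow> complex) \<Rightarrow> int \<Rightarrow> 'r set" where
  "modular_forms \<Gamma> F ev k =
     {f. \<forall>A\<in>\<Gamma>. \<forall>\<^sub>F z in F. ev f (moebius A z) = aut_factor A z powi k * ev f z}"

text \<open>
  An algebra of functions in one variable \<open>z\<close>.  The type \<open>'r\<close> is the algebra, an integral
  domain, and \<open>ev f\<close> is the function of \<open>z\<close> given by its element \<open>f\<close>.  Such a function need not be
  defined everywhere, so identities between functions are read as holding for \<open>F\<close>-almost all
  \<open>z\<close>, and an element is determined by its values at \<open>F\<close>-almost all \<open>z\<close>.  For functions on a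
  \<open>\<Gamma>\<close>-stable open set \<open>U\<close> take \<open>F = principal U\<close>, for rational functions \<open>F = cofinite\<close>, for
  meromorphic functions on a \<open>\<Gamma>\<close>-stable connected open set \<open>U\<close> take \<open>F = cosparse U\<close>.

  \<open>cst\<close> embeds the constants, so \<open>cst c * f\<close> is multiplication by the scalar \<open>c\<close>; \<open>D\<close> is
  differentiation with respect to \<open>z\<close>.  As \<open>F\<close> is preserved by \<open>moebius A\<close> for \<open>A \<in> \<Gamma>\<close>, the
  element whose existence is required in \<open>act_closed\<close> is unique, and the resulting maps
  form a right action of \<open>\<Gamma>\<close> by algebra automorphisms.
\<close>

locale modular_function_algebra =
  fixes \<Gamma> :: "(complex^2^2) set"
    and F :: "complex filter"
    and ev :: "'r::idom \<Rightarrow> complex \<Rightarrow> complex"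
    and cst :: "complex \<Rightarrow> 'r"
    and D :: "'r \<Rightarrow> 'r"
  assumes subgroup_SL2C: "subgroup \<Gamma> SL2C"
    and F_open: "\<And>P. eventually P F \<Longrightarrow> \<forall>\<^sub>F z in F. \<forall>\<^sub>F y in nhds z. P y"
    and F_stable: "\<And>A. A \<in> \<Gamma> \<Longrightarrow> filterlim (moebius A) F F"
    and ev_eqI: "\<And>f g. \<forall>\<^sub>F z in F. ev f z = ev g z \<Longrightarrow> f = g"
    and ev_add: "\<And>f g. \<forall>\<^sub>F z in F. ev (f + g) z = ev f z + ev g z"
    and ev_mult: "\<And>f g. \<forall>\<^sub>F z in F. ev (f * g) z = ev f z * ev g z"
    and ev_cst: "\<And>c. \<forall>\<^sub>F z in F. ev (cst c) z = c"
    and act_closed: "\<And>A f. A \<in> \<Gamma> \<Longrightarrow> \<exists>h. \<forall>\<^sub>F z in F. ev h z = ev f (moebius A z)"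
    and aut_factor_unit:
      "\<And>A. A \<in> \<Gamma> \<Longrightarrow> \<exists>w. w dvd 1 \<and> (\<forall>\<^sub>F z in F. ev w z = aut_factor A z)"
    and ev_D: "\<And>f. \<forall>\<^sub>F z in F. (ev f has_field_derivative ev (D f) z) (at z)"
    and D_nonzero: "\<exists>f. D f \<noteq> 0"
    and weights_disjoint:
      "\<And>k l. k \<noteq> l \<Longrightarrow> modular_forms \<Gamma> F ev k \<inter> modular_forms \<Gamma> F ev l = {0}"

text \<open>
  The skew power series ring over \<open>'r\<close> with commutation law
  \<open>x f = (\<Sum>n. d^n(f) x^(n+1))\<close>, \<open>d = - D\<close>.  Its elements are represented by their coefficients on
  the left, with \<open>'r fps\<close> as the underlying additive group; its product is \<open>skew_mult D\<close>, not the
  commutative product of \<open>'r fps\<close>.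

  \<open>skew_coeff D p n f\<close> is the coefficient of \<open>x^(p+n)\<close> in \<open>x^p f\<close>; the recursion applies
  the commutation law to every term of \<open>x^(p+1) f = x (x^p f)\<close>.
\<close>

fun skew_coeff :: "('r::idom \<Rightarrow> 'r) \<Rightarrow> nat \<Rightarrow> nat \<Rightarrow> 'r \<Rightarrow> 'r" where
  "skew_coeff D 0 n f = (if n = 0 then f else 0)"
| "skew_coeff D (Suc p) n f = (\<Sum>l\<le>n. ((\<lambda>h. - D h) ^^ l) (skew_coeff D p (n - l) f))"

definition skew_mult :: "('r::idom \<Rightarrow> 'r) \<Rightarrow> 'r fps \<Rightarrow> 'r fps \<Rightarrow> 'r fps" where
  "skew_mult D a b = Abs_fps (\<lambda>m. \<Sum>p\<le>m. \<Sum>q\<le>m - p.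
     fps_nth a p * skew_coeff D p (m - p - q) (fps_nth b q))"

fun skew_power :: "('r::idom \<Rightarrow> 'r) \<Rightarrow> 'r fps \<Rightarrow> nat \<Rightarrow> 'r fps" where
  "skew_power D a 0 = 1"
| "skew_power D a (Suc n) = skew_mult D a (skew_power D a n)"

lemma skew_mult_X_const:
  assumes "D 0 = 0"
  shows "skew_mult D fps_X (fps_const f) =
    Abs_fps (\<lambda>m. if m = 0 then 0 else ((\<lambda>h. - D h) ^^ (m - 1)) f)"
proof (rule fps_ext)
  fix m
  have pow0: "((\<lambda>h. - D h) ^^ l) 0 = 0" for l
    by (induction l) (auto simp: assms)
  have sk0: "skew_coeff D p n 0 = 0" for p n
    by (induction p arbitrary: n) (auto simp: pow0)
  have c1: "skew_coeff D (Suc 0) n f = ((\<lambda>h. - D h) ^^ n) f" for n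
  proof -
    have "skew_coeff D (Suc 0) n f = (\<Sum>l\<le>n. if l = n then ((\<lambda>h. - D h) ^^ n) f else 0)"
      unfolding skew_coeff.simps by (rule sum.cong) (auto simp: pow0)
    then show ?thesis by simp
  qed
  have inner: "(\<Sum>q\<le>n. fps_nth fps_X p * skew_coeff D p (n - q) (fps_nth (fps_const f) q)) =
      (if p = 1 then ((\<lambda>h. - D h) ^^ n) f else 0)" for p n
  proof -
    have "(\<Sum>q\<le>n. fps_nth fps_X p * skew_coeff D p (n - q) (fps_nth (fps_const f) q)) =
        (\<Sum>q\<le>n. if q = 0 then (if p = 1 then ((\<lambda>h. - D h) ^^ n) f else 0) else 0)"
      by (rule sum.cong) (auto simp: sk0 c1 fps_X_def simp del: skew_coeff.simps)
    then show ?thesis by simp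
  qed
  show "fps_nth (skew_mult D fps_X (fps_const f)) m = fps_nth
      (Abs_fps (\<lambda>m. if m = 0 then 0 else ((\<lambda>h. - D h) ^^ (m - 1)) f)) m"
    unfolding skew_mult_def fps_nth_Abs_fps inner by (cases m) simp_all
qed

definition psi :: "(complex \<Rightarrow> 'r) \<Rightarrow> ('r::idom \<Rightarrow> 'r) \<Rightarrow> nat \<Rightarrow> 'r \<Rightarrow> 'r fps" where
  "psi cst D j f =
     (if j = 0 then fps_const f
      else Abs_fps (\<lambda>m. if m < j then 0 else
        (let n = m - j in
          cst (fact (2 * j - 1) * fact (n + j - 1) / (fact (n + 2 * j - 1) * fact (j - 1)) *
               ((- of_nat j - 1) gchoose n)) * (D ^^ n) f)))"

text \<open>
  A family \<open>f\<close> stands for the formal sum of the \<open>f j\<close>, of weight \<open>2 j\<close>.  Since \<open>psi cst D j (f j)\<close>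
  has no terms of degree below \<open>j\<close>, each coefficient of the infinite sum is a finite sum.
\<close>

definition Psi2 :: "(complex \<Rightarrow> 'r) \<Rightarrow> ('r::idom \<Rightarrow> 'r) \<Rightarrow> (nat \<Rightarrow> 'r) \<Rightarrow> 'r fps" where
  "Psi2 cst D f = Abs_fps (\<lambda>m. \<Sum>j\<le>m. fps_nth (psi cst D j (f j)) m)"

text \<open>
  Tuples are lists.  For \<open>k + i \<ge> 1\<close> no factorial below has a negative argument when
  \<open>length t = k\<close> and \<open>sum_list t = i\<close>.  For \<open>k = i = 0\<close> the truncated subtraction turns
  \<open>(-1)!\<close> and \<open>(-2)!\<close> into \<open>1\<close>; in the formula for the components of the powers of \<open>u\<close> each of
  them occurs once in a numerator and once in a denominator.
\<close>

definition gamma_coeff :: "nat \<Rightarrow> nat \<Rightarrow> nat list \<Rightarrow> complex" where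
  "gamma_coeff k i t =
     (\<Sum>r\<le>i. (-1) ^ r * (fact (2 * k + 2 * i - 2 - r) / fact (k + i - 1 - r)) *
       (\<Sum>b | length b = k \<and> sum_list b = r \<and> (\<forall>j<k. b ! j \<le> t ! j).
          \<Prod>j<k. of_nat ((t ! j + 1) choose (b ! j))))"

text \<open>
  The binomial coefficient of two integers, extended to negative lower argument by the symmetry
  \<open>(n choose m) = (n choose (n - m))\<close> where \<open>m \<le> n\<close>, and by \<open>0\<close> otherwise.  It vanishes
  for \<open>m < 0 \<le> n\<close>, while \<open>(-1 choose -1) = 1\<close>.
\<close>

definition int_binomial :: "int \<Rightarrow> int \<Rightarrow> complex" where
  "int_binomial n m =
     (if m \<ge> 0 then of_int n gchoose nat m
      else if m \<le> n then of_int n gchoose nat (n - m) else 0)"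

end

theory Submission
  imports Defs
begin

text \<open>
  The variable \<open>x\<close> acts as the inverse of \<open>d/dz\<close>: the commutation law says
  \<open>x\<^sup>-\<^sup>1 f = f x\<^sup>-\<^sup>1 + f'\<close>. Replace \<open>x\<^sup>m\<close> by \<open>T\<^sup>m / m!\<close>. On series without constant term,
  left multiplication by \<open>x\<^sup>-\<^sup>1\<close> then becomes the derivation \<open>d/dT + d/dz\<close> of a commutative ring
  of power series. It maps
  \<open>E = (\<Sum>s. (-1)\<^sup>s \<chi>\<^sup>(\<^sup>s\<^sup>) / (s + 1)! T\<^sup>s\<^sup>+\<^sup>1)\<close>, the integral of \<open>\<chi>\<close> from
  \<open>z - T\<close> to \<open>z\<close>, to \<open>\<chi>\<close>. As \<open>x\<^sup>-\<^sup>1 u\<^sup>k = \<chi> u\<^sup>k\<^sup>-\<^sup>1\<close>, the image of \<open>u\<^sup>k\<close> is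
  \<open>E\<^sup>k / k!\<close> (\<open>borel_skew_power\<close>), which gives every coefficient of \<open>u\<^sup>k\<close>.

  The coefficients of \<open>psi\<close> form a triangular system whose inverse is explicit
  (\<open>Psi2_inversion\<close>): that the two are inverse to each other is the vanishing of an \<open>N\<close>-th finite
  difference of a polynomial of degree below \<open>N\<close> (\<open>alternating_sum_binomial_shift\<close>). The inverse expresses
  \<open>g k (k + i)\<close> by the \<open>r\<close>-th derivatives of the coefficients of \<open>u\<^sup>k\<close> in degree \<open>k + i - r\<close>. The
  Leibniz rule distributes these derivatives over the factors \<open>\<chi>\<^sup>(\<^sup>s\<^sup>)\<close>, and collecting the terms with the
  same total orders \<open>t\<^sub>j\<close> yields \<open>gamma_coeff\<close> (\<open>taylor_backward_average_power\<close>,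
  \<open>Psi2_preimage_skew_power\<close>).

  For the second expression of \<open>\<gamma>\<close> put \<open>K = k + i - 1\<close>. The sum over \<open>b\<close> is a coefficient of the product of
  the polynomials \<open>(1 + y) ^ (t\<^sub>j + 1) - y ^ (t\<^sub>j + 1)\<close>, and \<open>\<gamma> / K!\<close> is the image of this product under
  the linear functional sending \<open>y\<^sup>r\<close> to \<open>(-1)\<^sup>r (2 K - r choose K)\<close>. Expanding the product gives terms
  \<open>\<plusminus> (1 + y)\<^sup>a y\<^sup>K\<^sup>+\<^sup>1\<^sup>-\<^sup>a\<close>, one for each set of indices, whose images are again finite differences
  and equal \<open>(K - 1 choose a - 1)\<close> up to sign (\<open>functionals_agree_on_monomials\<close>,
  \<open>gamma_coeff_eq_delta_sum\<close>).
\<close>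

section \<open>Finite differences and coefficients of products\<close>

text \<open>
  Pascal's rule turns the alternating sum of order \<open>N + 1\<close> into the one of order \<open>N\<close> for the
  difference of consecutive values.
\<close>
lemma alternating_sum_binomial_Suc:
  fixes h :: "nat \<Rightarrow> 'a::comm_ring_1"
  shows "(\<Sum>l\<le>Suc N. (-1) ^ l * of_nat (Suc N choose l) * h l) =
    (\<Sum>l\<le>N. (-1) ^ l * of_nat (N choose l) * (h l - h (Suc l)))"
proof -
  have "(\<Sum>l\<le>N. (-1) ^ l * of_nat (N choose l) * h l) =
      (\<Sum>l\<le>Suc N. (-1) ^ l * of_nat (N choose l) * h l)"
    by (simp add: binomial_eq_0)
  also have "\<dots> = h 0 - (\<Sum>l\<le>N. (-1) ^ l * of_nat (N choose Suc l) * h (Suc l))"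
    by (subst sum.atMost_Suc_shift) (simp add: sum_negf)
  finally show ?thesis
    by (subst sum.atMost_Suc_shift)
      (simp add: algebra_simps sum_subtractf sum.distrib sum_negf)
qed

text \<open>
  The \<open>N\<close>-th finite difference lowers the lower index of a binomial coefficient by \<open>N\<close>, since
  each single difference lowers it by one. The inversion of \<open>Psi2\<close> uses the case \<open>q < N\<close>, where
  a polynomial of degree below \<open>N\<close> is annihilated; the second form of \<open>gamma_coeff\<close> uses both.
\<close>
lemma alternating_sum_binomial_shift:
  "(\<Sum>l\<le>N. (-1) ^ l * of_nat (N choose l) * of_nat ((M + N - l) choose q)) =
     (if q < N then 0 else of_nat (M choose (q - N)) :: 'a::comm_ring_1)"
proof (induction N arbitrary: q)
  case 0
  then show ?case by simp
next
  case (Suc N)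
  have "(\<Sum>l\<le>Suc N. (-1) ^ l * of_nat (Suc N choose l) * of_nat ((M + Suc N - l) choose q)) =
      (\<Sum>l\<le>N. (-1) ^ l * of_nat (N choose l) *
        (of_nat ((M + Suc N - l) choose q) - of_nat ((M + N - l) choose q) :: 'a))"
    by (subst alternating_sum_binomial_Suc) simp
  also have "\<dots> = (if q < Suc N then 0 else of_nat (M choose (q - Suc N)))"
  proof (cases q)
    case 0
    then show ?thesis by simp
  next
    case (Suc q')
    have "of_nat ((M + Suc N - l) choose q) - of_nat ((M + N - l) choose q) =
        (of_nat ((M + N - l) choose q') :: 'a)" if "l \<le> N" for l
      using that by (simp add: Suc Suc_diff_le)
    then show ?thesis
      using Suc.IH[of q'] by (simp add: Suc)
  qed
  finally show ?case .
qed

lemma fps_prod_nth_lists: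
  fixes a :: "nat \<Rightarrow> 'a::comm_ring_1 fps"
  shows "fps_nth (\<Prod>j<k. a j) n =
    (\<Sum>v | length v = k \<and> sum_list v = n. \<Prod>j<k. fps_nth (a j) (v ! j))"
proof (cases k)
  case 0
  have "{v :: nat list. v = [] \<and> sum_list v = n} = (if n = 0 then {[]} else {})"
    by auto
  then show ?thesis using 0 by simp
next
  case (Suc m)
  have "{0..m} = {..<Suc m}" by auto
  then show ?thesis
    using fps_prod_nth[of a m n] by (simp add: Suc natpermute_def)
qed

lemma finite_compositions: "finite {v :: nat list. length v = k \<and> sum_list v = n}"
  using natpermute_finite[of n k] by (simp add: natpermute_def)

lemma fps_one_plus_X_power_nth:
  "fps_nth ((1 + fps_X) ^ m) n = (of_nat (m choose n) :: 'a::comm_ring_1)"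
proof (induction m arbitrary: n)
  case 0
  then show ?case by (cases n) auto
next
  case (Suc m)
  then show ?case by (cases n) (auto simp: algebra_simps)
qed

lemma fps_const_prod: "(\<Prod>x\<in>A. fps_const (f x)) = fps_const (\<Prod>x\<in>A. f x)"
  by (induction A rule: infinite_finite_induct) auto

section \<open>The two expressions for \<open>\<gamma>\<close>\<close>

text \<open>
  Removing its top term from \<open>(1 + X) ^ (t\<^sub>j + 1)\<close> is what imposes \<open>b\<^sub>j \<le> t\<^sub>j\<close>. The sum over
  \<open>r\<close> may then run up to \<open>k + i\<close>, the largest degree of a single term in the expanded product:
  beyond \<open>i\<close> the terms cancel and the coefficients vanish.
\<close>
lemma gamma_coeff_generating_function:
  fixes t :: "nat list"
  assumes "length t = k" "sum_list t = i" "k + i \<ge> 2"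
  shows "gamma_coeff k i t / fact (k + i - 1) =
      (\<Sum>r\<le>k + i. (-1) ^ r * of_nat ((2 * (k + i - 1) - r) choose (k + i - 1)) *
         fps_nth (\<Prod>j<k. (1 + fps_X) ^ (t ! j + 1) - fps_X ^ (t ! j + 1)) r)"
proof -
  define K where "K = k + i - 1"
  define V where "V j = (1 + fps_X) ^ (t ! j + 1) - (fps_X ^ (t ! j + 1) :: complex fps)" for j
  have V_nth: "fps_nth (V j) n = (if n \<le> t ! j then of_nat ((t ! j + 1) choose n) else 0)" for j n
    unfolding V_def fps_sub_nth fps_one_plus_X_power_nth fps_X_power_nth
    by auto
  have beta: "fps_nth (\<Prod>j<k. V j) r =
      (\<Sum>b | length b = k \<and> sum_list b = r \<and> (\<forall>j<k. b ! j \<le> t ! j).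
          \<Prod>j<k. of_nat ((t ! j + 1) choose (b ! j)))" for r
    unfolding fps_prod_nth_lists
  proof (rule sum.mono_neutral_cong_right)
    show "\<forall>b\<in>{v. length v = k \<and> sum_list v = r} -
        {b. length b = k \<and> sum_list b = r \<and> (\<forall>j<k. b ! j \<le> t ! j)}.
        (\<Prod>j<k. fps_nth (V j) (b ! j)) = 0"
      by (auto simp: V_nth intro!: prod_zero)
  qed (auto simp: V_nth finite_compositions)
  have zero: "fps_nth (\<Prod>j<k. V j) r = 0" if "r > i" for r
  proof -
    have "{b. length b = k \<and> sum_list b = r \<and> (\<forall>j<k. b ! j \<le> t ! j)} = {}"
    proof -
      have "sum_list b \<le> i" if "length b = k" "\<forall>j<k. b ! j \<le> t ! j" for b
        using that assms by (auto simp: sum_list_sum_nth intro!: sum_mono)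
      then show ?thesis using \<open>r > i\<close> by force
    qed
    then show ?thesis unfolding beta by (simp only: sum.empty)
  qed
  have "k > 0" using assms by (cases k) auto
  then have K: "2 * k + 2 * i - 2 = 2 * K" "i \<le> K" by (auto simp: K_def)
  have "gamma_coeff k i t / fact K =
      (\<Sum>r\<le>i. (-1) ^ r * (fact (2 * K - r) / (fact K * fact (K - r))) *
         fps_nth (\<Prod>j<k. V j) r)"
    unfolding gamma_coeff_def beta K
    by (simp add: K_def sum_divide_distrib mult_ac)
  also have "\<dots> = (\<Sum>r\<le>i. (-1) ^ r * of_nat ((2 * K - r) choose K) * fps_nth (\<Prod>j<k. V j) r)"
  proof (rule sum.cong[OF refl])
    fix r assume "r \<in> {..i}"
    then have "K \<le> 2 * K - r" "2 * K - r - K = K - r" using K by auto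
    then have "of_nat ((2 * K - r) choose K) = (fact (2 * K - r) / (fact K * fact (K - r)) :: complex)"
      using binomial_fact[of K "2 * K - r"] by simp
    then show "(-1) ^ r * (fact (2 * K - r) / (fact K * fact (K - r))) *
         fps_nth (\<Prod>j<k. V j) r = (-1) ^ r * of_nat ((2 * K - r) choose K) * fps_nth (\<Prod>j<k. V j) r"
      by simp
  qed
  also have "\<dots> = (\<Sum>r\<le>k + i. (-1) ^ r * of_nat ((2 * K - r) choose K) * fps_nth (\<Prod>j<k. V j) r)"
    by (rule sum.mono_neutral_left) (auto simp: zero)
  finally show ?thesis unfolding K_def V_def by (simp add: mult_ac)
qed

text \<open>
  The two Kronecker symbols in the factor for \<open>j\<close> are the coefficients of a binomial whose
  exponents \<open>0\<close> and \<open>t\<^sub>j + 1\<close> differ, so the sum over the tuples is the coefficient sum of a product.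
\<close>
lemma delta_sum_generating_function:
  fixes t :: "nat list" and c :: "nat \<Rightarrow> complex"
  shows "(\<Sum>a | length a = k \<and> sum_list a \<le> K. c (sum_list a) *
      (\<Prod>j<k. (-1) ^ (t ! j) * of_bool (a ! j = 0) + of_bool (a ! j = t ! j + 1))) =
    (\<Sum>s\<le>K. c s *
       fps_nth (\<Prod>j<k. fps_X ^ (t ! j + 1) + fps_const ((-1) ^ (t ! j))) s)"
proof -
  have nth: "fps_nth (fps_X ^ (t ! j + 1) + fps_const ((-1) ^ (t ! j))) n =
      ((-1) ^ (t ! j) * of_bool (n = 0) + of_bool (n = t ! j + 1) :: complex)" for j n
    by (auto simp: fps_X_power_nth)
  have "{a :: nat list. length a = k \<and> sum_list a \<le> K} =
      (\<Union>s\<in>{..K}. {a. length a = k \<and> sum_list a = s})"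
    by auto
  then show ?thesis
    unfolding fps_prod_nth_lists nth sum_distrib_left
    by (simp only:) (subst sum.UNION_disjoint, auto simp: finite_compositions intro!: sum.cong)
qed

text \<open>
  Both sides of the identity for \<open>\<gamma>\<close> are linear functionals applied to products of binomials,
  and each product expands over the subsets of the index set. This compares the two functionals on
  the terms belonging to one subset: \<open>a\<close> collects the exponents \<open>t\<^sub>j + 1\<close> in the subset and
  \<open>b\<close> those outside it.
\<close>
lemma functionals_agree_on_monomials:
  assumes "K \<ge> 1" "a + b = K + 1"
  shows "(\<Sum>r\<le>K + 1. (-1) ^ r * of_nat ((2 * K - r) choose K) *
      fps_nth ((1 + fps_X) ^ a * (fps_const c * fps_X ^ b)) r) =
    (\<Sum>s\<le>K. int_binomial (int K - 1) (int s - 1) *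
      fps_nth (fps_X ^ a * fps_const ((-1) ^ b * c)) s)"
proof -
  have eq: "fps_nth ((1 + fps_X) ^ a * (fps_const c * fps_X ^ b)) r =
      (if r < b then 0 else c * of_nat (a choose (r - b)))" for r
  proof -
    have "fps_nth ((1 + fps_X) ^ a * (fps_const c * fps_X ^ b)) r =
      fps_nth (fps_const c * ((1 + fps_X) ^ a * fps_X ^ b)) r"
      by (simp add: mult_ac)
    then show ?thesis
      by (simp add: fps_X_power_mult_right_nth fps_one_plus_X_power_nth)
  qed
  have "(\<Sum>r\<le>K + 1. (-1) ^ r * of_nat ((2 * K - r) choose K) *
      fps_nth ((1 + fps_X) ^ a * (fps_const c * fps_X ^ b)) r) =
    (\<Sum>r\<in>{b..a + b}. (-1) ^ r * of_nat ((2 * K - r) choose K) * (c * of_nat (a choose (r - b))))"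
    unfolding eq using assms by (intro sum.mono_neutral_cong_right) auto
  also have "\<dots> = (\<Sum>l\<le>a. (-1) ^ b * c *
      ((-1) ^ l * of_nat (a choose l) * of_nat ((K - 1 + a - l) choose K)))"
  proof (rule sum.reindex_bij_witness[of _ "\<lambda>l. l + b" "\<lambda>r. r - b"])
    fix r assume r: "r \<in> {b..a + b}"
    then have e: "K - 1 + a - (r - b) = 2 * K - r" using assms by auto
    have "(-1) ^ r = ((-1) ^ b * (-1) ^ (r - b) :: complex)"
      using r by (simp flip: power_add)
    then show "(-1) ^ b * c * ((-1) ^ (r - b) * of_nat (a choose (r - b)) *
        of_nat ((K - 1 + a - (r - b)) choose K)) =
        (-1) ^ r * of_nat ((2 * K - r) choose K) * (c * of_nat (a choose (r - b)))"
      unfolding e by simp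
  qed auto
  also have "\<dots> = (-1) ^ b * c * (if K < a then 0 else of_nat ((K - 1) choose (K - a)))"
    unfolding sum_distrib_left[symmetric] by (subst alternating_sum_binomial_shift) simp
  also have "\<dots> = (if a \<le> K then int_binomial (int K - 1) (int a - 1) * ((-1) ^ b * c) else 0)"
  proof (cases "a = 0")
    case True
    have "int_binomial (int K - 1) (int a - 1) = of_nat ((K - 1) choose K)"
      using True assms by (simp add: int_binomial_def of_nat_diff binomial_gbinomial)
    then show ?thesis using True by simp
  next
    case False
    have "int_binomial (int K - 1) (int a - 1) = of_nat ((K - 1) choose (a - 1))"
      using False assms
      by (simp add: int_binomial_def of_nat_diff binomial_gbinomial nat_diff_distrib')
    also have "(K - 1) choose (a - 1) = (K - 1) choose (K - a)" if "a \<le> K"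
      using that False by (subst binomial_symmetric) auto
    finally show ?thesis by (auto simp: not_le)
  qed
  also have "\<dots> = (\<Sum>s\<le>K. if s = a then int_binomial (int K - 1) (int s - 1) * ((-1) ^ b * c) else 0)"
    by simp
  also have "\<dots> = (\<Sum>s\<le>K. int_binomial (int K - 1) (int s - 1) *
      fps_nth (fps_X ^ a * fps_const ((-1) ^ b * c)) s)"
    by (intro sum.cong) (auto simp: fps_X_power_nth)
  finally show ?thesis .
qed

text \<open>
  Expand both generating products over the subsets \<open>J\<close> of the indices and compare term by term.
  The case \<open>k + i = 1\<close> is separate because there the upper index \<open>k + i - 2\<close> is negative.
\<close>
lemma gamma_coeff_eq_delta_sum:
  assumes "length t = k" "sum_list t = i" "k + i \<ge> 1"
  shows "gamma_coeff k i t / fact (k + i - 1) =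
      (\<Sum>a | length a = k \<and> sum_list a \<le> k + i - 1.
         int_binomial (int k + int i - 2) (int (sum_list a) - 1) *
         (\<Prod>j<k. (-1) ^ (t ! j) * of_bool (a ! j = 0) + of_bool (a ! j = t ! j + 1)))"
proof (cases "k + i = 1")
  case True
  then have [simp]: "k = 1" "i = 0" using assms by (cases k; auto)+
  have t: "t = [0]" using assms by (cases t) auto
  have "{a :: nat list. length a = Suc 0 \<and> (\<forall>x\<in>set a. x = 0)} = {[0]}"
    by (auto simp: length_Suc_conv)
  moreover have "{b :: nat list. length b = Suc 0 \<and> (\<forall>x\<in>set b. x = 0) \<and> b ! 0 = 0} = {[0]}"
    by (auto simp: length_Suc_conv)
  ultimately show ?thesis
    by (simp add: t gamma_coeff_def int_binomial_def)
next
  case False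
  define K where "K = k + i - 1"
  have K: "K \<ge> 1" "K + 1 = k + i" using False assms by (auto simp: K_def)
  define L where "L p = (\<Sum>r\<le>K + 1. (-1) ^ r * of_nat ((2 * K - r) choose K) * fps_nth p r)"
    for p :: "complex fps"
  define L' where "L' p = (\<Sum>s\<le>K. int_binomial (int K - 1) (int s - 1) * fps_nth p s)"
    for p :: "complex fps"
  have sums: "L (\<Sum>x\<in>A. p x) = (\<Sum>x\<in>A. L (p x))" "L' (\<Sum>x\<in>A. p x) = (\<Sum>x\<in>A. L' (p x))"
    for A :: "nat set set" and p
    unfolding L_def L'_def fps_sum_nth sum_distrib_left by (rule sum.swap)+
  have "gamma_coeff k i t / fact (k + i - 1) =
      L (\<Prod>j<k. (1 + fps_X) ^ (t ! j + 1) + - (fps_X ^ (t ! j + 1)))"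
    using gamma_coeff_generating_function[of t k i] assms K unfolding L_def K_def by simp
  also have "\<dots> = (\<Sum>J\<in>Pow {..<k}.
      L ((\<Prod>j\<in>J. (1 + fps_X) ^ (t ! j + 1)) * (\<Prod>j\<in>{..<k} - J. - (fps_X ^ (t ! j + 1)))))"
    by (simp only: prod_add[OF finite_lessThan] sums)
  also have "\<dots> = (\<Sum>J\<in>Pow {..<k}.
      L' ((\<Prod>j\<in>J. fps_X ^ (t ! j + 1)) * (\<Prod>j\<in>{..<k} - J. fps_const ((-1) ^ (t ! j)))))"
  proof (rule sum.cong[OF refl])
    fix J assume "J \<in> Pow {..<k}"
    then have J: "J \<subseteq> {..<k}" "finite J" by (auto intro: finite_subset)
    define a where "a = (\<Sum>j\<in>J. t ! j + 1)"
    define b where "b = (\<Sum>j\<in>{..<k} - J. t ! j + 1)"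
    define c :: complex where "c = (\<Prod>j\<in>{..<k} - J. - 1)"
    have "a + b = (\<Sum>j<k. t ! j + 1)"
      unfolding a_def b_def using J by (metis add.commute finite_lessThan sum.subset_diff)
    also have "\<dots> = K + 1"
      using assms K unfolding sum.distrib by (simp add: sum_list_sum_nth atLeast0LessThan)
    finally have ab: "a + b = K + 1" .
    have 1: "(\<Prod>j\<in>J. (1 + fps_X) ^ (t ! j + 1)) = ((1 + fps_X) ^ a :: complex fps)"
      "(\<Prod>j\<in>J. fps_X ^ (t ! j + 1)) = (fps_X ^ a :: complex fps)"
      unfolding a_def power_sum by simp_all
    have 2: "(\<Prod>j\<in>{..<k} - J. - (fps_X ^ (t ! j + 1))) = fps_const c * fps_X ^ b"
    proof -
      have "(\<Prod>j\<in>{..<k} - J. - (fps_X ^ (t ! j + 1))) =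
          (\<Prod>j\<in>{..<k} - J. fps_const (- 1 :: complex) * fps_X ^ (t ! j + 1))"
        by (simp flip: fps_const_neg)
      then show ?thesis
        unfolding prod.distrib b_def power_sum c_def fps_const_prod by simp
    qed
    have "(-1) ^ b * c = (\<Prod>j\<in>{..<k} - J. (-1) ^ (t ! j))"
      unfolding b_def c_def power_sum prod.distrib[symmetric] by simp
    then have 3: "(\<Prod>j\<in>{..<k} - J. fps_const ((-1) ^ (t ! j))) = fps_const ((-1) ^ b * c)"
      by (simp only: fps_const_prod)
    show "L ((\<Prod>j\<in>J. (1 + fps_X) ^ (t ! j + 1)) * (\<Prod>j\<in>{..<k} - J. - (fps_X ^ (t ! j + 1)))) =
      L' ((\<Prod>j\<in>J. fps_X ^ (t ! j + 1)) * (\<Prod>j\<in>{..<k} - J. fps_const ((-1) ^ (t ! j))))"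
      unfolding 1 2 3 L_def L'_def by (rule functionals_agree_on_monomials[OF K(1) ab])
  qed
  also have "\<dots> = L' (\<Prod>j<k. fps_X ^ (t ! j + 1) + fps_const ((-1) ^ (t ! j)))"
    by (simp only: prod_add[OF finite_lessThan] sums)
  also have "\<dots> = (\<Sum>a | length a = k \<and> sum_list a \<le> K. int_binomial (int K - 1) (int (sum_list a) - 1) *
      (\<Prod>j<k. (-1) ^ (t ! j) * of_bool (a ! j = 0) + of_bool (a ! j = t ! j + 1)))"
    unfolding L'_def
    using delta_sum_generating_function[where k = k and K = K and t = t and c = "\<lambda>s. int_binomial (int K - 1) (int s - 1)"] by simp
  finally show ?thesis
    using K unfolding K_def by (simp add: of_nat_diff algebra_simps)
qed

section \<open>Complex differential algebras\<close>

lemma minus_one_power_diff: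
  assumes "r \<le> n"
  shows "(-1) ^ (n - r) = ((-1) ^ n * (-1) ^ r :: 'a::comm_ring_1)"
proof -
  obtain d where "n = r + d" using assms le_Suc_ex by blast
  then show ?thesis by (cases "even r"; cases "even d") auto
qed

text \<open>
  The structure on the algebra of functions that determines the preimages of the powers of \<open>u\<close>
  under \<open>Psi2\<close>: scalars and a derivation that kills them.
\<close>
locale complex_differential_algebra =
  fixes cst :: "complex \<Rightarrow> 'r::idom" and D :: "'r \<Rightarrow> 'r"
  assumes cst_1 [simp]: "cst 1 = 1"
    and cst_add: "cst (a + b) = cst a + cst b"
    and cst_mult: "cst (a * b) = cst a * cst b"
    and D_add: "D (f + h) = D f + D h"
    and D_mult: "D (f * h) = D f * h + f * D h"
    and D_cst [simp]: "D (cst c) = 0"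
begin

lemma cst_0 [simp]: "cst 0 = 0"
  using cst_add[of 0 0] by (metis add.right_neutral add_left_cancel)

lemma cst_minus: "cst (- a) = - cst a"
  using cst_add[of a "- a"] by (simp add: eq_neg_iff_add_eq_0 add.commute)

lemma cst_sum: "cst (\<Sum>x\<in>A. f x) = (\<Sum>x\<in>A. cst (f x))"
  by (induction A rule: infinite_finite_induct) (auto simp: cst_add)

lemma cst_prod: "cst (\<Prod>x\<in>A. f x) = (\<Prod>x\<in>A. cst (f x))"
  by (induction A rule: infinite_finite_induct) (auto simp: cst_mult)

lemma cst_of_nat: "cst (of_nat n) = of_nat n"
  by (induction n) (auto simp: cst_add)

text \<open>
  Characteristic zero is inherited from the scalars.
\<close>
lemma of_nat_Suc_mult_cancel:
  fixes f h :: 'r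
  assumes "of_nat (Suc n) * f = of_nat (Suc n) * h"
  shows "f = h"
proof -
  have inv: "cst (1 / of_nat (Suc n)) * of_nat (Suc n) = 1"
    unfolding cst_of_nat[symmetric] cst_mult[symmetric] by (simp del: of_nat_Suc)
  have "cst (1 / of_nat (Suc n)) * of_nat (Suc n) * f = cst (1 / of_nat (Suc n)) * of_nat (Suc n) * h"
    by (simp only: mult.assoc assms)
  then show ?thesis
    unfolding inv by simp
qed

lemma D_0 [simp]: "D 0 = 0"
  using D_cst[of 0] by simp

lemma D_scale: "D (cst c * f) = cst c * D f"
  by (simp add: D_mult)

lemma D_funpow_add: "(D ^^ n) (f + h) = (D ^^ n) f + (D ^^ n) h"
  by (induction n) (auto simp: D_add)

lemma D_funpow_scale: "(D ^^ n) (cst c * f) = cst c * (D ^^ n) f"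
  by (induction n) (auto simp: D_scale)

lemma D_sum: "D (\<Sum>x\<in>A. f x) = (\<Sum>x\<in>A. D (f x))"
  by (induction A rule: infinite_finite_induct) (auto simp: D_add)

lemma D_funpow_0 [simp]: "(D ^^ n) 0 = 0"
  by (induction n) auto

lemma D_funpow_sum: "(D ^^ n) (\<Sum>x\<in>A. f x) = (\<Sum>x\<in>A. (D ^^ n) (f x))"
  by (induction A rule: infinite_finite_induct) (auto simp: D_funpow_add)

section \<open>Powers of \<open>u\<close> in the skew power series ring\<close>

text \<open>
  Comparison of coefficients in \<open>x\<^sup>-\<^sup>1 y = x\<^sup>p f\<close> for \<open>y = x\<^sup>p\<^sup>+\<^sup>1 f\<close>, where
  \<open>x\<^sup>-\<^sup>1 h = h x\<^sup>-\<^sup>1 + h'\<close> for each coefficient \<open>h\<close> of \<open>y\<close>. This avoids the sum over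
  all derivatives.
\<close>
lemma skew_coeff_rec:
  "skew_coeff D (Suc p) n f =
    skew_coeff D p n f - (if n = 0 then 0 else D (skew_coeff D (Suc p) (n - 1) f))"
proof (cases n)
  case (Suc n')
  let ?d = "\<lambda>h. - D h"
  have "(\<Sum>l\<le>n'. - D ((?d ^^ l) (skew_coeff D p (n' - l) f))) =
      - D (\<Sum>l\<le>n'. (?d ^^ l) (skew_coeff D p (n' - l) f))"
    by (simp add: sum_negf D_sum)
  then show ?thesis
    unfolding Suc skew_coeff.simps by (subst sum.atMost_Suc_shift) simp
qed simp

text \<open>
  With \<open>u = x \<chi>\<close> and \<open>y = u b\<close> this says \<open>x\<^sup>-\<^sup>1 y = \<chi> b\<close>, because
  \<open>x\<^sup>-\<^sup>1\<close> satisfies \<open>x\<^sup>-\<^sup>1 f = f x\<^sup>-\<^sup>1 + f'\<close>. The recursion determines \<open>u b\<close> and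
  replaces the double sum in the definition of the product.
\<close>
lemma skew_mult_X_chi_rec:
  fixes chi :: 'r and b :: "'r fps"
  defines "y \<equiv> fps_nth (skew_mult D (skew_mult D fps_X (fps_const chi)) b)"
  shows "y 0 = 0" and "y (Suc m) + D (y m) = chi * fps_nth b m"
proof -
  define u where "u = skew_mult D fps_X (fps_const chi)"
  define w where "w p = ((\<lambda>h. - D h) ^^ p) chi" for p
  have w_rec: "w (Suc p) = - D (w p)" for p by (simp add: w_def)
  have u_0: "fps_nth u 0 = 0" and u_Suc: "fps_nth u (Suc l) = w l" for l
    unfolding u_def w_def skew_mult_X_const[of D, OF D_0] by simp_all
  let ?s = "\<lambda>p n q. skew_coeff D p n (fps_nth b q)"
  show y_0: "y 0 = 0"
    by (simp add: y_def skew_mult_def u_0 flip: u_def)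
  have y_Suc: "y (Suc m) = (\<Sum>p\<le>m. \<Sum>q\<le>m - p. w p * ?s (Suc p) (m - p - q) q)" for m
    unfolding y_def u_def[symmetric] unfolding skew_mult_def fps_nth_Abs_fps
    by (subst sum.atMost_Suc_shift) (simp add: u_0 u_Suc del: skew_coeff.simps)
  show "y (Suc m) + D (y m) = chi * fps_nth b m"
  proof (cases m)
    case 0
    then show ?thesis by (simp add: y_0 y_Suc w_def)
  next
    case (Suc M)
    have "y (Suc m) = (\<Sum>p\<le>Suc M. \<Sum>q\<le>Suc M - p. w p * ?s p (Suc M - p - q) q) -
        (\<Sum>p\<le>Suc M. \<Sum>q\<le>Suc M - p. w p * (if Suc M - p - q = 0 then 0
          else D (?s (Suc p) (Suc M - p - q - 1) q)))"
      unfolding y_Suc Suc by (subst skew_coeff_rec) (simp only: right_diff_distrib sum_subtractf)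
    also have "(\<Sum>p\<le>Suc M. \<Sum>q\<le>Suc M - p. w p * ?s p (Suc M - p - q) q) =
        chi * fps_nth b m + (\<Sum>p\<le>M. \<Sum>q\<le>M - p. w (Suc p) * ?s (Suc p) (M - p - q) q)"
    proof -
      have "(\<Sum>q\<le>Suc M. w 0 * ?s 0 (Suc M - q) q) =
          (\<Sum>q\<le>Suc M. if q = Suc M then chi * fps_nth b m else 0)"
        by (intro sum.cong) (auto simp: w_def Suc)
      then show ?thesis
        by (subst sum.atMost_Suc_shift) (simp del: skew_coeff.simps)
    qed
    also have "(\<Sum>p\<le>Suc M. \<Sum>q\<le>Suc M - p. w p * (if Suc M - p - q = 0 then 0
          else D (?s (Suc p) (Suc M - p - q - 1) q))) =
        (\<Sum>p\<le>M. \<Sum>q\<le>M - p. w p * D (?s (Suc p) (M - p - q) q))"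
    proof -
      have "(\<Sum>q\<le>Suc M - p. w p * (if Suc M - p - q = 0 then 0
          else D (?s (Suc p) (Suc M - p - q - 1) q))) =
        (\<Sum>q\<le>M - p. w p * D (?s (Suc p) (M - p - q) q))" if "p \<le> M" for p
        by (rule sum.mono_neutral_cong_right)
          (use that in \<open>auto simp del: skew_coeff.simps simp: Suc_diff_le\<close>)
      then show ?thesis by (simp del: skew_coeff.simps)
    qed
    also have "chi * fps_nth b m + (\<Sum>p\<le>M. \<Sum>q\<le>M - p. w (Suc p) * ?s (Suc p) (M - p - q) q) -
        (\<Sum>p\<le>M. \<Sum>q\<le>M - p. w p * D (?s (Suc p) (M - p - q) q)) =
        chi * fps_nth b m - D (y m)"
      unfolding Suc y_Suc
      by (simp add: D_sum D_mult w_rec sum.distrib sum_negf del: skew_coeff.simps)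
    finally show ?thesis by simp
  qed
qed

text \<open>
  Dividing the coefficient of \<open>x\<^sup>m\<close> by \<open>m!\<close> turns left multiplication by \<open>x\<^sup>-\<^sup>1\<close>, on series
  without constant term, into a derivation of a commutative power series ring, namely
  \<open>total_derivation\<close> below.
\<close>
definition borel_transform :: "'r fps \<Rightarrow> 'r fps" where
  "borel_transform a = Abs_fps (\<lambda>m. cst (1 / fact m) * fps_nth a m)"

text \<open>
  In a formal variable \<open>T\<close>, this is the mean value of \<open>\<chi>\<close> over the segment from \<open>z - T\<close> to \<open>z\<close>,
  expanded by Taylor's formula at \<open>z\<close>; multiplied by \<open>T\<close> it is the integral of \<open>\<chi>\<close> over that segment.
\<close>
definition backward_average :: "'r \<Rightarrow> 'r fps" where
  "backward_average chi = Abs_fps (\<lambda>s. cst ((-1) ^ s / fact (s + 1)) * (D ^^ s) chi)"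

text \<open>
  The derivation \<open>d/dT + d/dz\<close>. It differentiates along the direction in which \<open>z - T\<close> is constant.
\<close>
definition total_derivation :: "'r fps \<Rightarrow> 'r fps" where
  "total_derivation a = fps_deriv a + Abs_fps (\<lambda>n. D (fps_nth a n))"

lemma total_derivation_nth:
  "fps_nth (total_derivation a) n = of_nat (Suc n) * fps_nth a (Suc n) + D (fps_nth a n)"
  by (simp add: total_derivation_def)

lemma total_derivation_mult:
  "total_derivation (a * b) = total_derivation a * b + a * total_derivation b"
proof -
  have "Abs_fps (\<lambda>n. D (fps_nth (a * b) n)) =
      Abs_fps (\<lambda>n. D (fps_nth a n)) * b + a * Abs_fps (\<lambda>n. D (fps_nth b n))"
    by (intro fps_ext) (simp add: D_sum fps_mult_nth D_mult sum.distrib)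
  then show ?thesis
    by (simp add: total_derivation_def algebra_simps)
qed

lemma total_derivation_const: "total_derivation (fps_const (cst c)) = 0"
  by (rule fps_ext) (simp add: total_derivation_nth)

lemma total_derivation_power:
  "total_derivation (a ^ Suc k) = of_nat (Suc k) * a ^ k * total_derivation a"
proof (induction k)
  case (Suc k)
  have "total_derivation (a ^ Suc (Suc k)) =
      total_derivation a * a ^ Suc k + a * (of_nat (Suc k) * a ^ k * total_derivation a)"
    by (simp only: power_Suc[of a "Suc k"] total_derivation_mult Suc.IH)
  also have "\<dots> = of_nat (Suc (Suc k)) * a ^ Suc k * total_derivation a"
    by (simp add: algebra_simps)
  finally show ?case .
qed simp

text \<open>
  The integral of \<open>\<chi>\<close> from \<open>z - T\<close> to \<open>z\<close> changes only at its upper end when \<open>z - T\<close> is kept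
  fixed, and there it changes at rate \<open>\<chi>(z)\<close>.
\<close>
lemma total_derivation_backward_average:
  "total_derivation (fps_X * backward_average chi) = fps_const chi"
proof (rule fps_ext)
  fix n
  have scale: "of_nat (Suc n) * cst ((-1) ^ n / fact (n + 1)) = cst ((-1) ^ n / fact n)"
    unfolding cst_of_nat[symmetric] cst_mult[symmetric]
    by (simp add: field_simps del: of_nat_Suc)
  have E_Suc: "fps_nth (fps_X * backward_average chi) (Suc n) =
      cst ((-1) ^ n / fact (n + 1)) * (D ^^ n) chi" for n
    by (simp add: backward_average_def)
  have deriv: "of_nat (Suc n) * fps_nth (fps_X * backward_average chi) (Suc n) =
      cst ((-1) ^ n / fact n) * (D ^^ n) chi"
    unfolding E_Suc mult.assoc[symmetric] scale ..
  show "fps_nth (total_derivation (fps_X * backward_average chi)) n =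
      fps_nth (fps_const chi) n"
    unfolding total_derivation_nth deriv
    by (cases n) (simp_all add: backward_average_def D_scale cst_minus del: fact_Suc)
qed

lemma total_derivation_borel_skew_mult:
  "total_derivation (borel_transform (skew_mult D (skew_mult D fps_X (fps_const chi)) b)) =
    fps_const chi * borel_transform b"
proof (rule fps_ext)
  fix m
  let ?y = "fps_nth (skew_mult D (skew_mult D fps_X (fps_const chi)) b)"
  have "of_nat (Suc m) * cst (1 / fact (Suc m)) = cst (1 / fact m)"
    unfolding cst_of_nat[symmetric] cst_mult[symmetric]
    by (simp add: field_simps del: of_nat_Suc)
  then have "fps_nth (total_derivation (borel_transform
        (skew_mult D (skew_mult D fps_X (fps_const chi)) b))) m =
      cst (1 / fact m) * (?y (Suc m) + D (?y m))"
    by (simp add: total_derivation_nth borel_transform_def D_scale distrib_left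
        mult.assoc[symmetric] del: of_nat_Suc fact_Suc)
  then show "fps_nth (total_derivation (borel_transform
        (skew_mult D (skew_mult D fps_X (fps_const chi)) b))) m =
      fps_nth (fps_const chi * borel_transform b) m"
    unfolding skew_mult_X_chi_rec by (simp add: borel_transform_def mult.left_commute)
qed

text \<open>
  The equation for the coefficient of \<open>T\<^sup>n\<close> determines the coefficient of \<open>T\<^sup>n\<^sup>+\<^sup>1\<close> from the one of \<open>T\<^sup>n\<close>.
\<close>
lemma total_derivation_inject:
  assumes "total_derivation a = total_derivation b" "fps_nth a 0 = fps_nth b 0"
  shows "a = b"
proof (rule fps_ext)
  fix n
  show "fps_nth a n = fps_nth b n"
  proof (induction n)
    case (Suc n)
    have "of_nat (Suc n) * fps_nth a (Suc n) = of_nat (Suc n) * fps_nth b (Suc n)"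
      using arg_cong[OF assms(1), of "\<lambda>c. fps_nth c n"] Suc.IH
      by (simp add: total_derivation_nth del: of_nat_Suc)
    then show ?case by (rule of_nat_Suc_mult_cancel)
  qed (simp add: assms)
qed

text \<open>
  If \<open>E\<close> is the integral of \<open>\<chi>\<close> from \<open>z - T\<close> to \<open>z\<close>, the transform of \<open>u\<^sup>k\<close> is \<open>E\<^sup>k / k!\<close>: both
  vanish at \<open>T = 0\<close> for \<open>k > 0\<close>, and for both the total derivation gives \<open>\<chi>\<close> times the series
  for \<open>k - 1\<close>.
\<close>
lemma borel_skew_power:
  "borel_transform (skew_power D (skew_mult D fps_X (fps_const chi)) k) =
    fps_const (cst (1 / fact k)) * (fps_X * backward_average chi) ^ k"
proof (induction k)
  case 0
  show ?case by (rule fps_ext) (simp add: borel_transform_def)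
next
  case (Suc k)
  let ?u = "skew_mult D fps_X (fps_const chi)"
  let ?E = "fps_X * backward_average chi"
  show ?case
  proof (rule total_derivation_inject)
    have "cst (1 / fact (Suc k)) * of_nat (Suc k) = cst (1 / fact k)"
      unfolding cst_of_nat[symmetric] cst_mult[symmetric]
      by (simp add: field_simps del: of_nat_Suc)
    then have scale: "fps_const (cst (1 / fact (Suc k))) * of_nat (Suc k) =
        fps_const (cst (1 / fact k))"
      by (simp only: fps_of_nat[symmetric] fps_const_mult)
    have "total_derivation (fps_const (cst (1 / fact (Suc k))) * ?E ^ Suc k) =
        fps_const (cst (1 / fact (Suc k))) * of_nat (Suc k) * ?E ^ k * fps_const chi"
      by (subst total_derivation_mult, subst total_derivation_power)
        (simp only: total_derivation_const total_derivation_backward_average mult.assoc mult_zero_left add_0)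
    then show "total_derivation (borel_transform (skew_power D ?u (Suc k))) =
        total_derivation (fps_const (cst (1 / fact (Suc k))) * ?E ^ Suc k)"
      unfolding scale skew_power.simps total_derivation_borel_skew_mult Suc.IH
      by (simp only: mult_ac)
    show "fps_nth (borel_transform (skew_power D ?u (Suc k))) 0 =
        fps_nth (fps_const (cst (1 / fact (Suc k))) * ?E ^ Suc k) 0"
      by (simp add: borel_transform_def skew_mult_X_chi_rec)
  qed
qed

lemma skew_power_nth:
  "fps_nth (skew_power D (skew_mult D fps_X (fps_const chi)) k) m =
    (if m < k then 0 else cst (fact m / fact k) * fps_nth (backward_average chi ^ k) (m - k))"
proof -
  let ?U = "skew_power D (skew_mult D fps_X (fps_const chi)) k"
  have "fps_nth ?U m = cst (fact m) * fps_nth (borel_transform ?U) m"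
    by (simp add: borel_transform_def mult.assoc[symmetric] cst_mult[symmetric])
  also have "\<dots> = (if m < k then 0 else cst (fact m) * cst (1 / fact k) * fps_nth (backward_average chi ^ k) (m - k))"
    unfolding borel_skew_power power_mult_distrib by (simp add: fps_X_power_mult_nth)
  finally show ?thesis by (simp add: cst_mult[symmetric])
qed

section \<open>Higher derivatives of products\<close>

definition taylor :: "'r \<Rightarrow> 'r fps" where
  "taylor f = Abs_fps (\<lambda>n. cst (1 / fact n) * (D ^^ n) f)"

lemma taylor_Suc: "of_nat (Suc n) * fps_nth (taylor f) (Suc n) = fps_nth (taylor (D f)) n"
proof -
  have "of_nat (Suc n) * cst (1 / fact (Suc n)) = cst (1 / fact n)"
    unfolding cst_of_nat[symmetric] cst_mult[symmetric]
    by (simp add: field_simps del: of_nat_Suc)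
  then show ?thesis
    by (simp add: taylor_def mult.assoc[symmetric] funpow_Suc_right
        del: of_nat_Suc fact_Suc funpow.simps(2))
qed

lemma taylor_add: "taylor (f + h) = taylor f + taylor h"
  by (rule fps_ext) (simp add: taylor_def D_funpow_add algebra_simps)

text \<open>
  The Leibniz rule of all orders at once; in this form it passes to products of any number of
  factors without multinomial coefficients. The induction uses that \<open>d/dT\<close> of the Taylor series of
  \<open>f\<close> is the Taylor series of \<open>D f\<close>.
\<close>
lemma taylor_mult: "taylor (f * h) = taylor f * taylor h"
proof (rule fps_ext)
  fix n
  show "fps_nth (taylor (f * h)) n = fps_nth (taylor f * taylor h) n"
  proof (induction n arbitrary: f h)
    case 0
    then show ?case by (simp add: taylor_def)
  next
    case (Suc n)
    have deriv: "fps_deriv (taylor f) = taylor (D f)" for f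
      by (rule fps_ext) (use taylor_Suc in simp)
    have "of_nat (Suc n) * fps_nth (taylor (f * h)) (Suc n) =
        fps_nth (taylor (D f) * taylor h + taylor f * taylor (D h)) n"
      by (simp only: taylor_Suc D_mult taylor_add fps_add_nth Suc.IH)
    also have "\<dots> = fps_nth (fps_deriv (taylor f * taylor h)) n"
      by (simp add: deriv add.commute)
    also have "\<dots> = of_nat (Suc n) * fps_nth (taylor f * taylor h) (Suc n)"
      by (simp only: fps_deriv_nth Suc_eq_plus1)
    finally have "of_nat (Suc n) * fps_nth (taylor (f * h)) (Suc n) =
        of_nat (Suc n) * fps_nth (taylor f * taylor h) (Suc n)" .
    then show ?case by (rule of_nat_Suc_mult_cancel)
  qed
qed

lemma taylor_1: "taylor 1 = 1"
proof (rule fps_ext)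
  fix n
  have "(D ^^ Suc m) 1 = 0" for m
    using D_cst[of 1] by (simp add: funpow_Suc_right del: funpow.simps(2))
  then show "fps_nth (taylor 1) n = fps_nth 1 n"
    by (cases n) (simp_all add: taylor_def del: funpow.simps(2))
qed

lemma taylor_prod: "taylor (\<Prod>x\<in>A. f x) = (\<Prod>x\<in>A. taylor (f x))"
  by (induction A rule: infinite_finite_induct) (auto simp: taylor_1 taylor_mult)

text \<open>
  Differentiating \<open>\<chi>\<^sup>(\<^sup>s\<^sup>)\<close> a further \<open>b\<close> times gives \<open>\<chi>\<^sup>(\<^sup>t\<^sup>)\<close> with \<open>t = s + b\<close>, and
  \<open>1 / (b! (s + 1)!) = (t + 1 choose b) / (t + 1)!\<close>. So the pairs of tuples \<open>(s, b)\<close> are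
  regrouped by their sum \<open>t\<close>, which produces the inner sum of \<open>gamma_coeff\<close>.
\<close>
lemma taylor_backward_average_power:
  assumes "r \<le> i"
  shows "cst (1 / fact r) * (D ^^ r) (fps_nth (backward_average chi ^ k) (i - r)) =
    (\<Sum>t | length t = k \<and> sum_list t = i.
       cst ((-1) ^ (i - r) *
         (\<Sum>b | length b = k \<and> sum_list b = r \<and> (\<forall>j<k. b ! j \<le> t ! j).
          \<Prod>j<k. of_nat ((t ! j + 1) choose (b ! j)))) *
         (\<Prod>j<k. cst (1 / fact (t ! j + 1)) * (D ^^ (t ! j)) chi))"
proof -
  let ?S = "{s. length s = k \<and> sum_list s = i - r}"
  let ?B = "{b. length b = k \<and> sum_list b = r}"
  let ?T = "{t. length t = k \<and> sum_list t = i}"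
  let ?Bt = "\<lambda>t. {b. length b = k \<and> sum_list b = r \<and> (\<forall>j<k. b ! j \<le> t ! j)}"
  let ?c = "\<lambda>s b. \<Prod>j<k. cst (1 / fact (b ! j)) * (cst ((-1) ^ (s ! j) / fact (s ! j + 1)) *
      (D ^^ (b ! j + s ! j)) chi)"
  define F where "F t b = cst ((-1) ^ (i - r) *
      (\<Prod>j<k. of_nat ((t ! j + 1) choose (b ! j)))) *
      (\<Prod>j<k. cst (1 / fact (t ! j + 1)) * (D ^^ (t ! j)) chi)" for t b :: "nat list"
  have "cst (1 / fact r) * (D ^^ r) (fps_nth (backward_average chi ^ k) (i - r)) =
      (\<Sum>s\<in>?S. cst (1 / fact r) * (D ^^ r) (\<Prod>j<k. fps_nth (backward_average chi) (s ! j)))"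
    using fps_prod_nth_lists[of "\<lambda>_. backward_average chi" k "i - r"]
    by (simp add: D_funpow_sum sum_distrib_left)
  also have "\<dots> = (\<Sum>s\<in>?S. fps_nth (taylor (\<Prod>j<k. fps_nth (backward_average chi) (s ! j))) r)"
    by (simp add: taylor_def)
  also have "\<dots> = (\<Sum>s\<in>?S. \<Sum>b\<in>?B. ?c s b)"
    unfolding taylor_prod fps_prod_nth_lists
    by (simp add: taylor_def backward_average_def D_funpow_scale funpow_add del: fact_Suc)
  also have "\<dots> = (\<Sum>(s, b)\<in>?S \<times> ?B. ?c s b)"
    by (rule sum.cartesian_product)
  also have "\<dots> = (\<Sum>(t, b)\<in>Sigma ?T ?Bt. F t b)"
  proof (rule sum.reindex_bij_witness[of _ "\<lambda>(t, b). (map2 (-) t b, b)" "\<lambda>(s, b). (map2 (+) s b, b)"])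
    fix sb assume "sb \<in> ?S \<times> ?B"
    then obtain s b where sb: "sb = (s, b)" "length s = k" "sum_list s = i - r"
      "length b = k" "sum_list b = r" by auto
    define t where "t = map2 (+) s b"
    have t_nth: "t ! j = s ! j + b ! j" if "j < k" for j
      using sb that by (simp add: t_def)
    have t_length: "length t = k" using sb by (simp add: t_def)
    have "sum_list t = sum_list s + sum_list b"
      using sb t_length by (simp add: sum_list_sum_nth t_nth sum.distrib)
    then have "sum_list t = i" using sb assms by simp
    then show "(case sb of (s, b) \<Rightarrow> (map2 (+) s b, b)) \<in> Sigma ?T ?Bt"
      using sb t_length t_nth by (auto simp flip: t_def)
    have "map2 (-) t b = s"
      using sb t_length by (intro nth_equalityI) (auto simp: t_nth)
    then show "(case case sb of (s, b) \<Rightarrow> (map2 (+) s b, b) of (t, b) \<Rightarrow> (map2 (-) t b, b)) = sb"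
      using sb by (simp flip: t_def)
    have "(-1) ^ (i - r) = (\<Prod>j<k. (-1) ^ (s ! j) :: complex)"
      using sb by (simp add: sum_list_sum_nth power_sum atLeast0LessThan flip: sb(3))
    then have "F t b = (\<Prod>j<k. cst ((-1) ^ (s ! j) * of_nat ((t ! j + 1) choose (b ! j)) *
        (1 / fact (t ! j + 1))) * (D ^^ (t ! j)) chi)"
      unfolding F_def by (simp only: cst_prod cst_mult prod.distrib mult_ac)
    also have "\<dots> = ?c s b"
    proof (rule prod.cong[OF refl])
      fix j assume "j \<in> {..<k}"
      then have j: "t ! j = b ! j + s ! j" using t_nth[of j] by simp
      have "of_nat ((t ! j + 1) choose (b ! j)) =
          (fact (t ! j + 1) / (fact (b ! j) * fact (s ! j + 1)) :: complex)"
        using binomial_fact[of "b ! j" "t ! j + 1"] by (simp add: j del: fact_Suc)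
      then show "cst ((-1) ^ (s ! j) * of_nat ((t ! j + 1) choose (b ! j)) *
          (1 / fact (t ! j + 1))) * (D ^^ (t ! j)) chi =
        cst (1 / fact (b ! j)) * (cst ((-1) ^ (s ! j) / fact (s ! j + 1)) * (D ^^ (b ! j + s ! j)) chi)"
        by (simp add: j mult.assoc[symmetric] cst_mult[symmetric] del: fact_Suc)
    qed
    finally show "(case case sb of (s, b) \<Rightarrow> (map2 (+) s b, b) of (t, b) \<Rightarrow> F t b) =
        (case sb of (s, b) \<Rightarrow> ?c s b)"
      using sb by (simp flip: t_def)
  next
    fix tb assume "tb \<in> Sigma ?T ?Bt"
    then obtain t b where tb: "tb = (t, b)" "length t = k" "sum_list t = i"
      "length b = k" "sum_list b = r" and le: "\<And>j. j < k \<Longrightarrow> b ! j \<le> t ! j" by auto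
    define s where "s = map2 (-) t b"
    have s_length: "length s = k" using tb by (simp add: s_def)
    have s_nth: "s ! j + b ! j = t ! j" if "j < k" for j
      using tb that le[OF that] by (simp add: s_def)
    have "(\<Sum>j<k. s ! j) + (\<Sum>j<k. b ! j) = (\<Sum>j<k. t ! j)"
      unfolding sum.distrib[symmetric] by (intro sum.cong) (simp_all add: s_nth)
    then have "sum_list s + sum_list b = sum_list t"
      using tb s_length by (simp add: sum_list_sum_nth atLeast0LessThan)
    then have "sum_list s = i - r" using tb by simp
    then show "(case tb of (t, b) \<Rightarrow> (map2 (-) t b, b)) \<in> ?S \<times> ?B"
      using tb s_length by (auto simp flip: s_def)
    have "map2 (+) s b = t"
      using tb s_length by (intro nth_equalityI) (auto simp: s_nth)
    then show "(case case tb of (t, b) \<Rightarrow> (map2 (-) t b, b) of (s, b) \<Rightarrow> (map2 (+) s b, b)) = tb"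
      using tb by (simp flip: s_def)
  qed
  also have "\<dots> = (\<Sum>t\<in>?T. \<Sum>b\<in>?Bt t. F t b)"
    by (rule sum.Sigma[symmetric])
      (auto simp: finite_compositions intro: finite_subset[OF _ finite_compositions[of k r]])
  finally show ?thesis
    unfolding F_def sum_distrib_left sum_distrib_right cst_sum .
qed

section \<open>Inverting \<open>Psi2\<close>\<close>

lemma psi_nth:
  assumes "j \<ge> 1" "m \<ge> j"
  shows "fps_nth (psi cst D j f) m =
    cst ((-1) ^ (m - j) * (fact m * fact (m - 1) * fact (2 * j - 1) /
      (fact j * fact (j - 1) * fact (m - j) * fact (m + j - 1)))) * (D ^^ (m - j)) f"
proof -
  define n where "n = m - j"
  have m: "m = j + n" using assms by (simp add: n_def)
  have "(- of_nat j - 1 :: complex) = - of_nat (j + 1)"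
    and "(of_nat (j + 1) + of_nat n - 1 :: complex) = of_nat (j + n)" by simp_all
  then have "(- of_nat j - 1 :: complex) gchoose n = (-1) ^ n * (of_nat (j + n) gchoose n)"
    by (simp only: gbinomial_minus)
  also have "(of_nat (j + n) gchoose n :: complex) = fact (j + n) / (fact n * fact j)"
    using binomial_fact[of n "j + n"] by (simp add: binomial_gbinomial)
  finally have gchoose: "(- of_nat j - 1 :: complex) gchoose n = (-1) ^ n * (fact m / (fact n * fact j))"
    by (simp add: m)
  have "n + 2 * j - 1 = m + j - 1" "n + j - 1 = m - 1"
    by (simp_all add: m)
  then have "fact (2 * j - 1) * fact (n + j - 1) / (fact (n + 2 * j - 1) * fact (j - 1)) *
      ((- of_nat j - 1 :: complex) gchoose n) =
    (-1) ^ n * (fact m * fact (m - 1) * fact (2 * j - 1) /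
      (fact j * fact (j - 1) * fact n * fact (m + j - 1)))"
    unfolding gchoose by (simp add: mult_ac)
  then show ?thesis
    using assms by (simp add: psi_def Let_def flip: n_def)
qed

text \<open>
  Up to factors depending on \<open>j\<close> or on \<open>m\<close> alone, the coefficient of \<open>x\<^sup>m\<close> in \<open>Psi2 cst D f\<close>,
  for \<open>m \<ge> 1\<close>, is the sum over \<open>j\<close> from \<open>1\<close> to \<open>m\<close> of
  \<open>(-1)\<^sup>n D\<^sup>n (f j) / (n! (n + 2 j - 1)!)\<close> with \<open>n = m - j\<close>. Inserting these into the right-hand
  side, the coefficient of \<open>D\<^sup>N (f j)\<close> with \<open>N = m - j\<close> is an \<open>N\<close>-th finite difference of
  a polynomial of degree \<open>N - 1\<close>, so only \<open>j = m\<close> survives.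
\<close>
lemma Psi2_inversion:
  assumes "m \<ge> 1"
  shows "f m = cst (fact m * fact (m - 1) / fact (2 * m - 2)) *
    (\<Sum>r<m. cst (fact (2 * m - 2 - r) / (fact r * fact (m - r) * fact (m - r - 1))) *
      (D ^^ r) (fps_nth (Psi2 cst D f) (m - r)))"
proof -
  define w :: "nat \<Rightarrow> complex"
    where "w r = fact (2 * m - 2 - r) / (fact r * fact (m - r) * fact (m - r - 1))" for r
  define e :: "nat \<Rightarrow> nat \<Rightarrow> complex"
    where "e j m = (-1) ^ (m - j) * (fact m * fact (m - 1) * fact (2 * j - 1) /
      (fact j * fact (j - 1) * fact (m - j) * fact (m + j - 1)))" for j m
  have Psi2_nth: "fps_nth (Psi2 cst D f) n = (\<Sum>j\<in>{1..n}. cst (e j n) * (D ^^ (n - j)) (f j))"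
    if "n \<ge> 1" for n
  proof -
    have "{..n} - {0} = {1..n}" by auto
    moreover have "fps_nth (psi cst D 0 (f 0)) n = 0" using that by (simp add: psi_def)
    ultimately have "fps_nth (Psi2 cst D f) n = (\<Sum>j\<in>{1..n}. fps_nth (psi cst D j (f j)) n)"
      by (simp add: Psi2_def sum.remove[of "{..n}" 0])
    then show ?thesis by (simp add: psi_nth e_def)
  qed
  have ortho: "(\<Sum>r\<le>m - j. w r * e j (m - r)) =
      (if j = m then fact (2 * m - 2) / (fact m * fact (m - 1)) else 0)"
    if j: "j \<in> {1..m}" for j
  proof (cases "j = m")
    case True
    then show ?thesis using assms by (simp add: w_def e_def mult_2)
  next
    case False
    define N where "N = m - j"
    have N: "N \<ge> 1" "m = N + j" using j False by (auto simp: N_def)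
    \<comment> \<open>The factors without \<open>r\<close>. What depends on \<open>r\<close> is \<open>(-1)\<^sup>r (N choose r)\<close> times a
      binomial coefficient with lower index \<open>N - 1\<close>, the difference of the arguments \<open>2 m - 2 - r\<close> and \<open>m - r + j - 1\<close> of the two factorials.\<close>
    define C :: complex
      where "C = (-1) ^ N * (fact (2 * j - 1) * fact (N - 1) / (fact j * fact (j - 1) * fact N))"
    have "w r * e j (m - r) = C * ((-1) ^ r * of_nat (N choose r) *
        of_nat ((2 * j - 2 + N + N - r) choose (N - 1)))" if "r \<le> N" for r
    proof -
      have 1: "(-1) ^ (N - r) = ((-1) ^ N * (-1) ^ r :: complex)"
        by (rule minus_one_power_diff[OF that])
      have 2: "of_nat (N choose r) = (fact N / (fact r * fact (N - r)) :: complex)"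
        using binomial_fact[OF that] by simp
      have eq: "2 * j - 2 + N + N - r = 2 * m - 2 - r"
        "2 * m - 2 - r - (N - 1) = m - r + j - 1" "m - r - j = N - r"
        using that N j by auto
      have "N - 1 \<le> 2 * m - 2 - r" using that N j by auto
      then have 3: "of_nat ((2 * j - 2 + N + N - r) choose (N - 1)) =
          (fact (2 * m - 2 - r) / (fact (N - 1) * fact (m - r + j - 1)) :: complex)"
        using binomial_fact[of "N - 1" "2 * m - 2 - r"] unfolding eq by simp
      show ?thesis
        unfolding w_def e_def C_def 2 3 unfolding eq 1 by (simp add: field_simps)
    qed
    then have "(\<Sum>r\<le>N. w r * e j (m - r)) = C * (\<Sum>r\<le>N. (-1) ^ r * of_nat (N choose r) *
        of_nat ((2 * j - 2 + N + N - r) choose (N - 1)))"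
      unfolding sum_distrib_left by (intro sum.cong) auto
    also have "\<dots> = 0"
      using N(1) by (subst alternating_sum_binomial_shift) simp
    finally show ?thesis using False by (simp add: N_def)
  qed
  have "(\<Sum>r<m. cst (w r) * (D ^^ r) (fps_nth (Psi2 cst D f) (m - r))) =
      (\<Sum>r<m. \<Sum>j\<in>{1..m - r}. cst (w r * e j (m - r)) * (D ^^ (m - j)) (f j))"
  proof (intro sum.cong refl)
    fix r assume "r \<in> {..<m}"
    then have "m - r \<ge> 1" by auto
    then have "cst (w r) * (D ^^ r) (fps_nth (Psi2 cst D f) (m - r)) =
        (\<Sum>j\<in>{1..m - r}. cst (w r * e j (m - r)) * (D ^^ r) ((D ^^ (m - r - j)) (f j)))"
      by (simp add: Psi2_nth D_funpow_sum D_funpow_scale sum_distrib_left cst_mult mult_ac)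
    also have "\<dots> = (\<Sum>j\<in>{1..m - r}. cst (w r * e j (m - r)) * (D ^^ (m - j)) (f j))"
    proof (intro sum.cong refl)
      fix j assume "j \<in> {1..m - r}"
      then have "r + (m - r - j) = m - j" by auto
      then have "(D ^^ r) ((D ^^ (m - r - j)) (f j)) = (D ^^ (m - j)) (f j)"
        by (metis comp_apply funpow_add)
      then show "cst (w r * e j (m - r)) * (D ^^ r) ((D ^^ (m - r - j)) (f j)) =
          cst (w r * e j (m - r)) * (D ^^ (m - j)) (f j)" by simp
    qed
    finally show "cst (w r) * (D ^^ r) (fps_nth (Psi2 cst D f) (m - r)) =
        (\<Sum>j\<in>{1..m - r}. cst (w r * e j (m - r)) * (D ^^ (m - j)) (f j))" .
  qed
  also have "\<dots> = (\<Sum>j\<in>{1..m}. \<Sum>r\<le>m - j. cst (w r * e j (m - r)) * (D ^^ (m - j)) (f j))"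
    unfolding sum.Sigma[OF finite_lessThan ballI[OF finite_atLeastAtMost]]
      sum.Sigma[OF finite_atLeastAtMost ballI[OF finite_atMost]]
    by (rule sum.reindex_bij_witness[of _ "\<lambda>(j, r). (r, j)" "\<lambda>(r, j). (j, r)"]) auto
  also have "\<dots> = (\<Sum>j\<in>{1..m}. cst (\<Sum>r\<le>m - j. w r * e j (m - r)) * (D ^^ (m - j)) (f j))"
    by (simp only: cst_sum sum_distrib_right)
  also have "\<dots> = (\<Sum>j\<in>{1..m}. if j = m then cst (fact (2 * m - 2) / (fact m * fact (m - 1))) * f m else 0)"
    by (intro sum.cong refl) (simp add: ortho)
  also have "\<dots> = cst (fact (2 * m - 2) / (fact m * fact (m - 1))) * f m"
    using assms by simp
  finally have *: "(\<Sum>r<m. cst (w r) * (D ^^ r) (fps_nth (Psi2 cst D f) (m - r))) =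
      cst (fact (2 * m - 2) / (fact m * fact (m - 1))) * f m" .
  show ?thesis
    unfolding w_def[symmetric] * mult.assoc[symmetric] cst_mult[symmetric] by simp
qed

text \<open>
  The inversion formula applied to the coefficients of \<open>u\<^sup>k\<close>. Since \<open>u\<^sup>k\<close> starts in degree \<open>k\<close>, only
  \<open>r \<le> i\<close> contributes in degree \<open>k + i\<close>.
\<close>
lemma Psi2_preimage_skew_power:
  assumes "Psi2 cst D f = skew_power D (skew_mult D fps_X (fps_const chi)) k"
  shows "n < k \<Longrightarrow> f n = 0"
    and "f (k + i) =
      cst ((-1) ^ i * (fact (k + i) * fact (k + i - 1)) / (fact (2 * k + 2 * i - 2) * fact k)) *
      (\<Sum>t | length t = k \<and> sum_list t = i.
         cst (gamma_coeff k i t) *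
         (\<Prod>j<k. cst (1 / fact (t ! j + 1)) * (D ^^ (t ! j)) chi))"
proof -
  have f_0: "f 0 = fps_nth (skew_power D (skew_mult D fps_X (fps_const chi)) k) 0"
    unfolding assms[symmetric] by (simp add: Psi2_def psi_def)
  show "f n = 0" if "n < k"
  proof (cases "n = 0")
    case True
    then show ?thesis using f_0 that by (simp add: skew_power_nth)
  next
    case False
    have "n - r < k" for r using that by simp
    then show ?thesis
      using False by (subst Psi2_inversion) (simp_all add: assms skew_power_nth)
  qed
  show "f (k + i) =
      cst ((-1) ^ i * (fact (k + i) * fact (k + i - 1)) / (fact (2 * k + 2 * i - 2) * fact k)) *
      (\<Sum>t | length t = k \<and> sum_list t = i.
         cst (gamma_coeff k i t) *
         (\<Prod>j<k. cst (1 / fact (t ! j + 1)) * (D ^^ (t ! j)) chi))"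
  proof (cases "k = 0")
    case True
    show ?thesis
    proof (cases "i = 0")
      case True
      have [simp]: "{t. t = [] \<and> (\<forall>x\<in>set t. x = (0::nat))} = {[]}"
        "{b. b = [] \<and> (\<forall>x\<in>set b. x = (0::nat))} = {[]}" by auto
      show ?thesis
        using f_0 True \<open>k = 0\<close> by (simp add: gamma_coeff_def)
    next
      case False
      then have "{t :: nat list. length t = k \<and> sum_list t = i} = {}"
        using \<open>k = 0\<close> by auto
      moreover have "f (k + i) = 0"
        using False \<open>k = 0\<close> by (subst Psi2_inversion) (auto simp: assms)
      ultimately show ?thesis by (simp only: sum.empty mult_zero_right)
    qed
  next
    case False
    define m where "m = k + i"
    have m: "m \<ge> 1" "i < m" "m - i = k" using False by (auto simp: m_def)
    let ?P = "\<lambda>t. \<Prod>j<k. cst (1 / fact (t ! j + 1)) * (D ^^ (t ! j)) chi"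
    define \<beta> :: "nat \<Rightarrow> nat list \<Rightarrow> complex"
      where "\<beta> r t = (\<Sum>b | length b = k \<and> sum_list b = r \<and> (\<forall>j<k. b ! j \<le> t ! j).
          \<Prod>j<k. of_nat ((t ! j + 1) choose (b ! j)))" for r t
    have summand: "cst (fact (2 * m - 2 - r) / (fact r * fact (m - r) * fact (m - r - 1))) *
        (D ^^ r) (fps_nth (Psi2 cst D f) (m - r)) =
      cst (1 / fact k) * (\<Sum>t | length t = k \<and> sum_list t = i. cst ((-1) ^ i *
        ((-1) ^ r * (fact (2 * m - 2 - r) / fact (m - 1 - r)) * \<beta> r t)) * ?P t)" if "r \<le> i" for r
    proof -
      have sgn: "(-1) ^ (i - r) = ((-1) ^ i * (-1) ^ r :: complex)"
        by (rule minus_one_power_diff[OF that])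
      have h: "fps_nth (Psi2 cst D f) (m - r) =
          cst (fact (m - r) / fact k) * fps_nth (backward_average chi ^ k) (i - r)"
        using that by (simp add: assms skew_power_nth m_def)
      have "cst (fact (2 * m - 2 - r) / (fact r * fact (m - r) * fact (m - r - 1))) *
          (D ^^ r) (fps_nth (Psi2 cst D f) (m - r)) =
        cst (1 / fact k * (fact (2 * m - 2 - r) / fact (m - 1 - r))) *
        (cst (1 / fact r) * (D ^^ r) (fps_nth (backward_average chi ^ k) (i - r)))"
        unfolding h D_funpow_scale mult.assoc[symmetric] cst_mult[symmetric]
        by (simp add: mult_ac diff_commute)
      also have "\<dots> = cst (1 / fact k) * (\<Sum>t | length t = k \<and> sum_list t = i.
          cst ((fact (2 * m - 2 - r) / fact (m - 1 - r)) * ((-1) ^ (i - r) * \<beta> r t)) * ?P t)"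
        unfolding taylor_backward_average_power[OF that] \<beta>_def[symmetric]
        by (simp only: cst_mult mult.assoc sum_distrib_left)
      finally show ?thesis unfolding sgn by (simp add: mult_ac)
    qed
    have "2 * m = 2 * k + 2 * i" by (simp add: m_def)
    then have gamma_eq: "gamma_coeff k i t =
        (\<Sum>r\<le>i. (-1) ^ r * (fact (2 * m - 2 - r) / fact (m - 1 - r)) * \<beta> r t)" for t
      unfolding gamma_coeff_def \<beta>_def by (simp only: m_def)
    have const_eq: "cst ((-1) ^ i / fact k) = cst (1 / fact k) * cst ((-1) ^ i)"
      by (simp flip: cst_mult)
    have "(\<Sum>r<m. cst (fact (2 * m - 2 - r) / (fact r * fact (m - r) * fact (m - r - 1))) *
        (D ^^ r) (fps_nth (Psi2 cst D f) (m - r))) =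
      (\<Sum>r\<le>i. cst (fact (2 * m - 2 - r) / (fact r * fact (m - r) * fact (m - r - 1))) *
        (D ^^ r) (fps_nth (Psi2 cst D f) (m - r)))"
      using m by (intro sum.mono_neutral_right) (auto simp: assms skew_power_nth)
    also have "\<dots> = (\<Sum>r\<le>i. cst (1 / fact k) * (\<Sum>t | length t = k \<and> sum_list t = i.
        cst ((-1) ^ i * ((-1) ^ r * (fact (2 * m - 2 - r) / fact (m - 1 - r)) * \<beta> r t)) * ?P t))"
      by (intro sum.cong refl summand) simp
    also have "\<dots> = cst (1 / fact k) * (\<Sum>t | length t = k \<and> sum_list t = i. cst ((-1) ^ i *
        (\<Sum>r\<le>i. (-1) ^ r * (fact (2 * m - 2 - r) / fact (m - 1 - r)) * \<beta> r t)) * ?P t)"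
      by (simp only: cst_sum sum_distrib_left sum_distrib_right) (rule sum.swap)
    also have "\<dots> = cst ((-1) ^ i / fact k) * (\<Sum>t | length t = k \<and> sum_list t = i.
        cst (gamma_coeff k i t) * ?P t)"
      unfolding gamma_eq[symmetric] const_eq by (simp only: cst_mult mult.assoc sum_distrib_left)
    finally show ?thesis
      unfolding m_def[symmetric] Psi2_inversion[OF m(1), of f]
      by (simp add: m_def mult.assoc[symmetric] cst_mult[symmetric]) (simp add: mult_ac)
  qed
qed

end

section \<open>Algebras of functions\<close>

context modular_function_algebra
begin

text \<open>
  \<open>D f\<close> may be computed from any function that agrees with \<open>ev f\<close> near almost every point; the
  openness of \<open>F\<close> supplies the neighbourhoods.
\<close>
lemma D_eqI:
  assumes "\<forall>\<^sub>F z in F. ev f z = G z"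
    and "\<forall>\<^sub>F z in F. (G has_field_derivative G' z) (at z)"
    and "\<forall>\<^sub>F z in F. ev h z = G' z"
  shows "D f = h"
proof (rule ev_eqI)
  show "\<forall>\<^sub>F z in F. ev (D f) z = ev h z"
    using F_open[OF assms(1)] assms(2,3) ev_D[of f]
  proof eventually_elim
    case (elim z)
    have "(ev f has_field_derivative G' z) (at z)"
      using elim(1,2) by (subst DERIV_cong_ev[OF refl _ refl]) auto
    then show ?case using elim(3,4) DERIV_unique by metis
  qed
qed

lemma is_complex_differential_algebra: "complex_differential_algebra cst D"
proof
  have cst_one_mult: "cst 1 * f = f" for f
  proof (rule ev_eqI)
    show "\<forall>\<^sub>F z in F. ev (cst 1 * f) z = ev f z"
      using ev_mult[of "cst 1" f] ev_cst[of 1] by eventually_elim simp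
  qed
  from this[of 1] show "cst 1 = 1" by simp
  show "cst (a + b) = cst a + cst b" for a b
  proof (rule ev_eqI)
    show "\<forall>\<^sub>F z in F. ev (cst (a + b)) z = ev (cst a + cst b) z"
      using ev_add[of "cst a" "cst b"] ev_cst[of a] ev_cst[of b] ev_cst[of "a + b"]
      by eventually_elim simp
  qed
  show "cst (a * b) = cst a * cst b" for a b
  proof (rule ev_eqI)
    show "\<forall>\<^sub>F z in F. ev (cst (a * b)) z = ev (cst a * cst b) z"
      using ev_mult[of "cst a" "cst b"] ev_cst[of a] ev_cst[of b] ev_cst[of "a * b"]
      by eventually_elim simp
  qed
  show "D (f + h) = D f + D h" for f h
  proof (rule D_eqI[OF ev_add])
    show "\<forall>\<^sub>F z in F. ((\<lambda>z. ev f z + ev h z) has_field_derivative ev (D f) z + ev (D h) z) (at z)"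
      using ev_D[of f] ev_D[of h] by eventually_elim (rule DERIV_add)
  qed (rule ev_add)
  show "D (f * h) = D f * h + f * D h" for f h
  proof (rule D_eqI[OF ev_mult])
    show "\<forall>\<^sub>F z in F. ((\<lambda>z. ev f z * ev h z) has_field_derivative
        ev (D f) z * ev h z + ev f z * ev (D h) z) (at z)"
      using ev_D[of f] ev_D[of h]
      by eventually_elim (auto intro!: derivative_eq_intros)
    show "\<forall>\<^sub>F z in F. ev (D f * h + f * D h) z = ev (D f) z * ev h z + ev f z * ev (D h) z"
      using ev_add[of "D f * h" "f * D h"] ev_mult[of "D f" h] ev_mult[of f "D h"]
      by eventually_elim simp
  qed
  show "D (cst c) = 0" for c
  proof (rule D_eqI[OF ev_cst])
    show "\<forall>\<^sub>F z in F. ((\<lambda>z. c) has_field_derivative 0) (at z)" by simp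
    show "\<forall>\<^sub>F z in F. ev 0 z = 0"
      using ev_add[of 0 0] by eventually_elim simp
  qed
qed

end

theorem proposition2p4p5:
  fixes \<Gamma> :: "(complex^2^2) set"
    and F :: "complex filter"
    and ev :: "'r::idom \<Rightarrow> complex \<Rightarrow> complex"
    and cst :: "complex \<Rightarrow> 'r"
    and D :: "'r \<Rightarrow> 'r"
    and chi :: 'r
    and u :: "'r fps"
    and g :: "nat \<Rightarrow> nat \<Rightarrow> 'r"
    and k i :: nat
  assumes "modular_function_algebra \<Gamma> F ev cst D"
    and "chi \<in> modular_forms \<Gamma> F ev 2"
    and "chi dvd 1"
    and "u = skew_mult D fps_X (fps_const chi)"
    and "\<And>n. g k n \<in> modular_forms \<Gamma> F ev (2 * int n)"
    and "Psi2 cst D (g k) = skew_power D u k"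
  shows "(\<forall>n<k. g k n = 0) \<and>
    g k (k + i) =
      cst ((-1) ^ i * (fact (k + i) * fact (k + i - 1)) / (fact (2 * k + 2 * i - 2) * fact k)) *
      (\<Sum>t | length t = k \<and> sum_list t = i.
         cst (gamma_coeff k i t) *
         (\<Prod>j<k. cst (1 / fact (t ! j + 1)) * (D ^^ (t ! j)) chi)) \<and>
    (\<forall>t. length t = k \<and> sum_list t = i \<and> k + i \<ge> 1 \<longrightarrow>
      gamma_coeff k i t / fact (k + i - 1) =
      (\<Sum>a | length a = k \<and> sum_list a \<le> k + i - 1.
         int_binomial (int k + int i - 2) (int (sum_list a) - 1) *
         (\<Prod>j<k. (-1) ^ (t ! j) * of_bool (a ! j = 0) + of_bool (a ! j = t ! j + 1))))"
proof -
  interpret modular_function_algebra \<Gamma> F ev cst D by fact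
  interpret complex_differential_algebra cst D by (rule is_complex_differential_algebra)
  have "Psi2 cst D (g k) = skew_power D (skew_mult D fps_X (fps_const chi)) k"
    using assms(4,6) by simp
  then show ?thesis
    using Psi2_preimage_skew_power gamma_coeff_eq_delta_sum by blast
qed

end
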